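(* A finite, undirected, connected graph $\Gamma$ is 3-GNDB with $\gamma_\Gamma=2$ if and only if $\Gamma$ is isomorphic to $K_{2,6}$.
   Context: All graphs are finite, simple, undirected and connected, with at least one edge. For vertices $a,b$, $d(a,b)$ denotes the length of a shortest $a$–$b$ path. For an edge $ab$, $W_{ab}=\{x\in V(\Gamma)\mid d(x,a)<d(x,b)\}$. A graph $\Gamma$ is called generalized 3-nicely distance-balanced (3-GNDB) if there is a positive integer $\gamma_\Gamma$ such that for every edge $ab$ of $\Gamma$, one of $|W_{ab}|,|W_{ba}|$ equals $3$ times the other, and the smaller of the two equals $\gamma_\Gamma$. *)

theory Defs
  imports "Graph_Theory.Graph_Theory"
begin

text \<open>
  Graphs are the library's \<^locale>\<open>graph\<close>: finite symmetric digraphs without loops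
  or parallel arcs. An edge \<open>ab\<close> corresponds to the two arcs \<open>a \<rightarrow> b\<close> and \<open>b \<rightarrow> a\<close>.
\<close>

text \<open>Meaningful only if a path from \<open>a\<close> to \<open>b\<close> exists, in particular in connected graphs.\<close>

definition graph_dist :: "('a, 'b) pre_digraph \<Rightarrow> 'a \<Rightarrow> 'a \<Rightarrow> nat" where
  "graph_dist G a b = (LEAST k. \<exists>p. pre_digraph.apath G a p b \<and> length p = k)"

definition closer_set :: "('a, 'b) pre_digraph \<Rightarrow> 'a \<Rightarrow> 'a \<Rightarrow> 'a set" where
  "closer_set G a b = {x \<in> verts G. graph_dist G x a < graph_dist G x b}"

text \<open>
  \<open>three_GNDB_with G \<gamma>\<close> says that \<open>G\<close> is 3-GNDB with \<open>\<gamma>\<^sub>G = \<gamma>\<close>; for a graph with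
  at least one edge, \<open>\<gamma>\<close> is uniquely determined.
\<close>

definition three_GNDB_with :: "('a, 'b) pre_digraph \<Rightarrow> nat \<Rightarrow> bool" where
  "three_GNDB_with G \<gamma> \<longleftrightarrow> \<gamma> > 0 \<and>
    (\<forall>a b. a \<rightarrow>\<^bsub>G\<^esub> b \<longrightarrow>
      (card (closer_set G a b) = 3 * card (closer_set G b a) \<or>
       card (closer_set G b a) = 3 * card (closer_set G a b)) \<and>
      min (card (closer_set G a b)) (card (closer_set G b a)) = \<gamma>)"

definition complete_bipartite :: "nat \<Rightarrow> nat \<Rightarrow> (nat + nat) pair_pre_digraph" where
  "complete_bipartite m n =
    \<lparr> pverts = Inl ` {..<m} \<union> Inr ` {..<n},
      parcs = (Inl ` {..<m}) \<times> (Inr ` {..<n}) \<union> (Inr ` {..<n}) \<times> (Inl ` {..<m}) \<rparr>"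

lemma complete_bipartite_digraph_complete_bipartite:
  "complete_bipartite_digraph m n (with_proj (complete_bipartite m n))"
  unfolding complete_bipartite_digraph_pair_def
proof (intro conjI exI)
  show "finite (pverts (complete_bipartite m n))"
    by (simp add: complete_bipartite_def)
  show "pverts (complete_bipartite m n) = Inl ` {..<m} \<union> Inr ` {..<n}"
    by (simp add: complete_bipartite_def)
  show "parcs (complete_bipartite m n) =
      (Inl ` {..<m}) \<times> (Inr ` {..<n}) \<union> (Inr ` {..<n}) \<times> (Inl ` {..<m})"
    by (simp add: complete_bipartite_def)
qed (auto simp: card_image)

end

theory Submission
  imports Defs
begin

unbundle no funcset_syntax

text \<open>
  Along an edge \<open>ab\<close> the total distance \<open>\<Sum>\<^sub>x d(x,v)\<close> changes by
  \<open>|W\<^sub>a\<^sub>b| - |W\<^sub>b\<^sub>a| = \<plusminus>4\<close>. Modulo 8 it is therefore a proper 2-colouring, so the graph is bipartite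
  and has \<open>2 + 6 = 8\<close> vertices. If \<open>|W\<^sub>b\<^sub>a| = 2\<close>, then \<open>W\<^sub>b\<^sub>a = {b, c}\<close> where \<open>a, c\<close> are the only
  neighbours of \<open>b\<close>, and every other neighbour of \<open>c\<close> is a neighbour of \<open>a\<close>. A 4-cycle with three
  vertices of degree 2 is impossible: the remaining four vertices would hang at its fourth vertex
  and form a \<open>K\<^sub>2\<^sub>,\<^sub>3\<close> with it, which has an edge violating the balance condition. The edge \<open>bc\<close> must
  then satisfy \<open>|W\<^sub>b\<^sub>c| = 2\<close>, so \<open>a\<close> and \<open>c\<close> have the same neighbours, all of them of degree 2.
\<close>

section \<open>Distances in connected graphs\<close>

context wf_digraph
begin

text \<open>Trades walks for powers of the adjacency relation, so that distances can be handled by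
  \<open>relpow\<close> rules. The induction splits off the first arc.\<close>

lemma awalk_length_iff_relpow:
  assumes "u \<in> verts G"
  shows "(\<exists>p. awalk u p v \<and> length p = k) \<longleftrightarrow> (u, v) \<in> arcs_ends G ^^ k"
  using assms
proof (induction k arbitrary: u)
  case 0
  then show ?case by (auto simp: awalk_Nil_iff)
next
  case (Suc k)
  have "(\<exists>p. awalk u p v \<and> length p = Suc k) \<longleftrightarrow> (\<exists>e p. awalk u (e # p) v \<and> length p = k)"
    by (metis length_Suc_conv)
  also have "\<dots> \<longleftrightarrow> (\<exists>e p. e \<in> arcs G \<and> u = tail G e \<and> awalk (head G e) p v \<and> length p = k)"
    by (simp add: awalk_Cons_iff)
  also have "\<dots> \<longleftrightarrow> (\<exists>e. e \<in> arcs G \<and> u = tail G e \<and> (head G e, v) \<in> arcs_ends G ^^ k)"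
    using Suc.IH[OF head_in_verts] by blast
  also have "\<dots> \<longleftrightarrow> (\<exists>w. (u, w) \<in> arcs_ends G \<and> (w, v) \<in> arcs_ends G ^^ k)"
    by (auto simp: arcs_ends_conv)
  also have "\<dots> \<longleftrightarrow> (u, v) \<in> arcs_ends G ^^ Suc k"
    by (metis relpow_Suc_I2 relpow_Suc_E2)
  finally show ?case .
qed

text \<open>Each step of \<open>awalk_to_apath\<close> cuts out a cycle. This links arbitrary walks
  to the paths over which \<open>graph_dist\<close> minimises.\<close>

lemma length_awalk_to_apath_le:
  assumes "awalk u p v"
  shows "length (awalk_to_apath p) \<le> length p"
  using assms
proof (induct rule: awalk_to_apath_induct)
  case (path p)
  then show ?case by (auto simp: awalk_to_apath.simps)
next
  case (decomp p q r s)
  have "p = q @ r @ s"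
    using decomp by (auto elim!: awalk_cyc_decompE)
  then show ?case
    using decomp step_awalk_to_apath[of u p v q r s] by simp
qed

lemma graph_dist_le_relpow:
  assumes "u \<in> verts G" "(u, v) \<in> arcs_ends G ^^ k"
  shows "graph_dist G u v \<le> k"
proof -
  obtain p where p: "awalk u p v" "length p = k"
    using awalk_length_iff_relpow assms by blast
  have "graph_dist G u v \<le> length (awalk_to_apath p)"
    unfolding graph_dist_def by (rule Least_le) (use apath_awalk_to_apath[OF p(1)] in blast)
  then show ?thesis
    using length_awalk_to_apath_le[OF p(1)] p(2) by simp
qed

text \<open>Reachability supplies a path, so the minimum is attained. With
  \<open>graph_dist_le_relpow\<close>, the distance is the least exponent whose relation power
  contains \<open>(u, v)\<close>.\<close>

lemma relpow_graph_dist: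
  assumes "u \<rightarrow>\<^sup>* v"
  shows "(u, v) \<in> arcs_ends G ^^ graph_dist G u v"
proof -
  have "\<exists>k p. apath u p v \<and> length p = k"
    using assms reachable_apath by blast
  then have "\<exists>p. apath u p v \<and> length p = graph_dist G u v"
    unfolding graph_dist_def by (rule LeastI_ex)
  then show ?thesis
    using awalk_length_iff_relpow assms reachable_in_verts(1) awalkI_apath by blast
qed

end

lemma relpow_sym:
  assumes "sym r" "(x, y) \<in> r ^^ k"
  shows "(y, x) \<in> r ^^ k"
  using assms(2)
proof (induction k arbitrary: y)
  case (Suc k)
  then obtain z where "(x, z) \<in> r ^^ k" "(z, y) \<in> r"
    by auto
  then show ?case
    using Suc.IH assms(1) by (meson relpow_Suc_I2 symD)
qed simp

locale connected_graph = graph +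
  assumes conn: "connected G"
begin

abbreviation d :: "'a \<Rightarrow> 'a \<Rightarrow> nat" where
  "d \<equiv> graph_dist G"

abbreviation W :: "'a \<Rightarrow> 'a \<Rightarrow> 'a set" where
  "W \<equiv> closer_set G"

lemma reach: "u \<in> verts G \<Longrightarrow> v \<in> verts G \<Longrightarrow> u \<rightarrow>\<^sup>* v"
  using symmetric_connected_imp_strongly_connected[OF sym_arcs conn] by blast

lemma adj_sym: "a \<rightarrow> b \<Longrightarrow> b \<rightarrow> a"
  using sym_arcs by (rule arcs_ends_symmetric)

lemma adj_commute: "a \<rightarrow> b \<longleftrightarrow> b \<rightarrow> a"
  using adj_sym by blast

lemma adj_neq: "a \<rightarrow> b \<Longrightarrow> a \<noteq> b"
  using adj_not_same by blast

text \<open>By connectedness every vertex is reachable from \<open>a\<close>, and no edge leaves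
  \<open>S\<close>. This turns knowledge of neighbourhoods into knowledge of the whole vertex
  set.\<close>

lemma closed_imp_verts:
  assumes "a \<in> S" "a \<in> verts G" "\<And>x y. x \<in> S \<Longrightarrow> x \<rightarrow> y \<Longrightarrow> y \<in> S"
  shows "verts G \<subseteq> S"
proof
  fix v assume "v \<in> verts G"
  with assms(2) have "a \<rightarrow>\<^sup>* v" by (rule reach)
  then show "v \<in> S"
    by (induction rule: reachable_induct) (use assms in auto)
qed

lemma dist_relpow: "u \<in> verts G \<Longrightarrow> v \<in> verts G \<Longrightarrow> (u, v) \<in> arcs_ends G ^^ d u v"
  by (rule relpow_graph_dist) (rule reach)

lemma dist_self [simp]: "u \<in> verts G \<Longrightarrow> d u u = 0"
  using graph_dist_le_relpow[of u u 0] by simp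

lemma dist_eq_0_iff: "u \<in> verts G \<Longrightarrow> v \<in> verts G \<Longrightarrow> d u v = 0 \<longleftrightarrow> u = v"
  using dist_relpow[of u v] by auto

lemma dist_commute:
  assumes "u \<in> verts G" "v \<in> verts G"
  shows "d u v = d v u"
proof -
  have "d y x \<le> d x y" if "x \<in> verts G" "y \<in> verts G" for x y
    using that(2) relpow_sym[OF sym_arcs[unfolded symmetric_def] dist_relpow[OF that]]
    by (rule graph_dist_le_relpow)
  then show ?thesis using assms by (simp add: antisym)
qed

lemma dist_adj_le: "x \<in> verts G \<Longrightarrow> a \<rightarrow> b \<Longrightarrow> d x b \<le> Suc (d x a)"
  using dist_relpow[of x a] adj_in_verts by (intro graph_dist_le_relpow) auto

lemma dist_eq_1_iff:
  assumes "u \<in> verts G" "v \<in> verts G"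
  shows "d u v = 1 \<longleftrightarrow> u \<rightarrow> v"
proof
  assume "d u v = 1"
  then show "u \<rightarrow> v" using dist_relpow[OF assms] by simp
next
  assume adj: "u \<rightarrow> v"
  then have "d u v \<le> 1" using dist_adj_le[of u u v] assms by simp
  moreover have "d u v \<noteq> 0" using adj adj_neq assms dist_eq_0_iff by simp
  ultimately show "d u v = 1" by simp
qed

lemma dist_ge_2: "u \<in> verts G \<Longrightarrow> v \<in> verts G \<Longrightarrow> u \<noteq> v \<Longrightarrow> \<not> u \<rightarrow> v \<Longrightarrow> 2 \<le> d u v"
  using dist_eq_0_iff[of u v] dist_eq_1_iff[of u v] by linarith

text \<open>\<open>z\<close> is the last vertex before \<open>a\<close> on a shortest walk from
  \<open>x\<close>.\<close>

lemma dist_predE: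
  assumes "x \<in> verts G" "a \<in> verts G" "x \<noteq> a"
  obtains z where "a \<rightarrow> z" "d x a = Suc (d x z)"
proof -
  obtain k where k: "d x a = Suc k"
    using assms dist_eq_0_iff by (cases "d x a") auto
  then obtain z where z: "(x, z) \<in> arcs_ends G ^^ k" "z \<rightarrow> a"
    using dist_relpow[OF assms(1,2)] by auto
  have "d x z \<le> k" using graph_dist_le_relpow[OF assms(1) z(1)] .
  moreover have "d x a \<le> Suc (d x z)" using dist_adj_le assms z by blast
  ultimately have "d x a = Suc (d x z)" using k by simp
  then show ?thesis using that adj_sym z(2) by blast
qed

section \<open>Closer sets and total distance\<close>

lemma closer_setD: "x \<in> W a b \<Longrightarrow> x \<in> verts G \<and> d x a < d x b"
  by (simp add: closer_set_def)

lemma finite_closer_set [simp]: "finite (W a b)"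
  by (simp add: closer_set_def)

lemma closer_set_disjoint: "W a b \<inter> W b a = {}"
  by (auto simp: closer_set_def)

lemma self_in_closer_set: "a \<rightarrow> b \<Longrightarrow> a \<in> W a b"
  using adj_in_verts[of a b] dist_eq_1_iff[of a b] by (simp add: closer_set_def)

text \<open>Crossing an edge changes each distance by at most 1, so a vertex contributes 1 on
  \<open>W a b\<close>, -1 on \<open>W b a\<close> and 0 elsewhere.\<close>

lemma sum_dist_diff:
  assumes "a \<rightarrow> b"
  shows "(\<Sum>x\<in>verts G. int (d x b)) - (\<Sum>x\<in>verts G. int (d x a)) = int (card (W a b)) - int (card (W b a))"
proof -
  have step: "int (d x b) - int (d x a) = of_bool (x \<in> W a b) - of_bool (x \<in> W b a)"
    if "x \<in> verts G" for x
    using dist_adj_le[OF that assms] dist_adj_le[OF that adj_sym[OF assms]] that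
    by (auto simp: closer_set_def)
  have count: "(\<Sum>x\<in>verts G. of_bool (x \<in> W u v)) = int (card (W u v))" for u v
  proof -
    have "verts G \<inter> {x. x \<in> W u v} = W u v"
      by (auto simp: closer_set_def)
    then show ?thesis by simp
  qed
  have "(\<Sum>x\<in>verts G. int (d x b)) - (\<Sum>x\<in>verts G. int (d x a))
      = (\<Sum>x\<in>verts G. of_bool (x \<in> W a b) - of_bool (x \<in> W b a))"
    unfolding sum_subtractf[symmetric] by (rule sum.cong) (simp_all add: step)
  also have "\<dots> = int (card (W a b)) - int (card (W b a))"
    by (simp only: sum_subtractf count)
  finally show ?thesis .
qed

text \<open>\<open>c\<close> follows \<open>b\<close> on a shortest path from \<open>b\<close> to
  \<open>x\<close>; it is not \<open>a\<close>, because \<open>a\<close> is farther from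
  \<open>x\<close> than \<open>b\<close> is.\<close>

lemma closer_set_obtain_neighbour:
  assumes "a \<rightarrow> b" "x \<in> W b a" "x \<noteq> b"
  obtains c where "b \<rightarrow> c" "c \<noteq> a" "d x b = Suc (d x c)"
proof -
  have x: "x \<in> verts G" "d x b < d x a" using closer_setD assms(2) by auto
  obtain c where c: "b \<rightarrow> c" "d x b = Suc (d x c)"
    using dist_predE[of x b] x(1) assms adj_in_verts by blast
  with x(2) have "c \<noteq> a" by auto
  with c show ?thesis using that by blast
qed

end

section \<open>Structure of the balanced graphs\<close>

locale gndb_2 = connected_graph +
  assumes gndb: "three_GNDB_with G 2"
begin

lemma card_closer_sets:
  assumes "a \<rightarrow> b"
  shows "card (W a b) = 2 \<and> card (W b a) = 6 \<or> card (W a b) = 6 \<and> card (W b a) = 2"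
proof -
  have "card (W a b) = 3 * card (W b a) \<or> card (W b a) = 3 * card (W a b)"
    "min (card (W a b)) (card (W b a)) = 2"
    using gndb assms unfolding three_GNDB_with_def by blast+
  then show ?thesis by linarith
qed

text \<open>Both 4 and -4 are congruent to 4 modulo 8, so every edge of a walk adds 4 to the total
  distance modulo 8, whatever the sign of the change.\<close>

lemma sum_dist_relpow:
  assumes "(x, y) \<in> arcs_ends G ^^ k"
  shows "8 dvd (\<Sum>v\<in>verts G. int (d v y)) - (\<Sum>v\<in>verts G. int (d v x)) - 4 * int k"
  using assms
proof (induction k arbitrary: y)
  case (Suc k)
  then obtain z where z: "(x, z) \<in> arcs_ends G ^^ k" "z \<rightarrow> y" by auto
  have "8 dvd (\<Sum>v\<in>verts G. int (d v y)) - (\<Sum>v\<in>verts G. int (d v z)) - 4"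
    using card_closer_sets[OF z(2)] unfolding sum_dist_diff[OF z(2)] by auto
  from dvd_add[OF this Suc.IH[OF z(1)]] show ?case
    by (simp add: algebra_simps)
qed simp

text \<open>Walks of equal length from \<open>x\<close> to \<open>a\<close> and to \<open>b\<close>
  would make the two total distances agree modulo 8, but along the edge they differ by 4 or -4. This
  is bipartiteness in the form used below.\<close>

lemma dist_adj_neq:
  assumes "x \<in> verts G" "a \<rightarrow> b"
  shows "d x a \<noteq> d x b"
proof
  assume eq: "d x a = d x b"
  have "8 dvd ((\<Sum>v\<in>verts G. int (d v b)) - (\<Sum>v\<in>verts G. int (d v a)))"
    using dvd_diff[OF sum_dist_relpow[OF dist_relpow[of x b]] sum_dist_relpow[OF dist_relpow[of x a]]]
      assms adj_in_verts eq by simp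
  then show False
    using card_closer_sets[OF assms(2)] unfolding sum_dist_diff[OF assms(2)] by auto
qed

lemma triangle_free: "a \<rightarrow> b \<Longrightarrow> b \<rightarrow> c \<Longrightarrow> \<not> a \<rightarrow> c"
  using dist_adj_neq[of a b c] dist_eq_1_iff adj_in_verts by metis

text \<open>No vertex is equidistant from \<open>a\<close> and \<open>b\<close>, so the two closer
  sets partition the vertices into 2 and 6.\<close>

lemma card_verts:
  assumes "a \<rightarrow> b"
  shows "card (verts G) = 8"
proof -
  have "verts G = W a b \<union> W b a"
    using dist_adj_neq[OF _ assms] by (auto simp: closer_set_def neq_iff)
  then have "card (verts G) = card (W a b) + card (W b a)"
    using card_Un_disjoint[OF _ _ closer_set_disjoint] by simp
  then show ?thesis using card_closer_sets[OF assms] by auto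
qed

section \<open>Neighbourhoods forced by a closer set of size 2\<close>

lemma second_neighbourE:
  assumes "b \<rightarrow> c"
  obtains x where "c \<rightarrow> x" "x \<noteq> b"
proof -
  have "W c b \<noteq> {c}" using card_closer_sets[OF assms] by auto
  then obtain y where "y \<in> W c b" "y \<noteq> c"
    using self_in_closer_set[OF adj_sym[OF assms]] by blast
  then show ?thesis
    using closer_set_obtain_neighbour[OF assms] that by blast
qed

text \<open>Without triangles, \<open>W b a\<close> contains \<open>b\<close> and all its neighbours
  except \<open>a\<close>, which leaves room for exactly one such neighbour \<open>c\<close>. A
  further neighbour of \<open>c\<close> is outside \<open>W b a\<close>, hence nearer to
  \<open>a\<close> than to \<open>b\<close>, and it is at distance at most 2 from
  \<open>b\<close>.\<close>

lemma small_closer_setE: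
  assumes ab: "a \<rightarrow> b" and card: "card (W b a) = 2"
  obtains c where "W b a = {b, c}" "c \<noteq> a" "b \<rightarrow> c" "\<And>x. b \<rightarrow> x \<longleftrightarrow> x = a \<or> x = c"
    "\<And>x. c \<rightarrow> x \<Longrightarrow> x \<noteq> b \<Longrightarrow> a \<rightarrow> x"
proof -
  have V: "a \<in> verts G" "b \<in> verts G" using adj_in_verts[OF ab] by auto
  have nbr: "x \<in> W b a" if "b \<rightarrow> x" "x \<noteq> a" for x
  proof -
    have "x \<in> verts G" using that(1) adj_in_verts by blast
    moreover have "d x b = 1" using that(1) adj_sym dist_eq_1_iff V \<open>x \<in> verts G\<close> by blast
    moreover have "2 \<le> d x a"
      using triangle_free[OF ab that(1)] that(2) adj_sym dist_ge_2 V \<open>x \<in> verts G\<close> by blast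
    ultimately show ?thesis by (simp add: closer_set_def)
  qed
  obtain c where c: "b \<rightarrow> c" "c \<noteq> a"
    using second_neighbourE[OF ab] by blast
  have "{b, c} \<subseteq> W b a" "b \<noteq> c"
    using nbr c adj_neq self_in_closer_set[OF adj_sym[OF ab]] by auto
  then have W: "W b a = {b, c}"
    using card by (metis card_2_iff card_subset_eq finite_closer_set)
  have "b \<rightarrow> x \<longleftrightarrow> x = a \<or> x = c" for x
    using nbr[of x] W c ab adj_sym adj_neq by blast
  moreover have "a \<rightarrow> x" if x: "c \<rightarrow> x" "x \<noteq> b" for x
  proof -
    have xV: "x \<in> verts G" "c \<in> verts G" using x adj_in_verts by auto
    have "x \<notin> W b a" using x W adj_neq by auto
    then have "d x a < d x b"
      using dist_adj_neq[OF xV(1) ab] xV(1) by (auto simp: closer_set_def)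
    moreover have "d x b \<le> 2"
      using dist_adj_le[OF xV(1) adj_sym[OF c(1)]] dist_eq_1_iff[OF xV] adj_sym[OF x(1)] by simp
    \<comment> \<open>Excludes \<open>x = a\<close>: as \<open>c\<close> is adjacent to
      \<open>b\<close> and strictly closer to \<open>b\<close> than to \<open>a\<close>, it is not
      adjacent to \<open>a\<close>.\<close>
    moreover have "d x a \<noteq> 0"
    proof -
      have "d c b = 1" "d c b < d c a"
        using c(1) adj_sym dist_eq_1_iff V xV W closer_setD[of c b a] by auto
      then have "\<not> c \<rightarrow> a" using dist_eq_1_iff[of c a] xV V by auto
      then show ?thesis using x dist_eq_0_iff[OF xV(1) V(1)] by auto
    qed
    ultimately have "d x a = 1" by simp
    then show ?thesis using dist_eq_1_iff xV V adj_sym by blast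
  qed
  ultimately show ?thesis using that W c by blast
qed

text \<open>The cycle \<open>a\<close>, \<open>b\<close>, \<open>c\<close>, \<open>e\<close> meets
  the rest of the graph only at \<open>a\<close>. Exploring from \<open>a\<close> determines the
  other four vertices, and the edge \<open>yz\<close> found there has at least three vertices on
  each side.\<close>

lemma no_pendant_4_cycle:
  assumes b: "\<And>x. b \<rightarrow> x \<longleftrightarrow> x = a \<or> x = c"
    and c: "\<And>x. c \<rightarrow> x \<longleftrightarrow> x = b \<or> x = e"
    and e: "\<And>x. e \<rightarrow> x \<longleftrightarrow> x = a \<or> x = c"
    and "a \<noteq> c" "b \<noteq> e"
  shows False
proof -
  have ab: "a \<rightarrow> b" and ae: "a \<rightarrow> e" and bc: "b \<rightarrow> c" and ce: "c \<rightarrow> e"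
    using b c e adj_sym by blast+
  have V: "a \<in> verts G" "b \<in> verts G" "c \<in> verts G" "e \<in> verts G"
    using ab ae bc adj_in_verts by auto
  have dist4: "a \<noteq> b" "a \<noteq> c" "a \<noteq> e" "b \<noteq> c" "b \<noteq> e" "c \<noteq> e"
    using ab ae bc ce adj_neq assms(4,5) by auto
  have "card {a, b, c, e} = 4" using dist4 by simp
  have "\<exists>y. a \<rightarrow> y \<and> y \<noteq> b \<and> y \<noteq> e"
  proof (rule ccontr)
    assume "\<not> ?thesis"
    then have "verts G \<subseteq> {a, b, c, e}"
      using closed_imp_verts[of a "{a, b, c, e}"] V b c e by blast
    then have "card (verts G) \<le> 4"
      using card_mono[of "{a, b, c, e}" "verts G"] \<open>card {a, b, c, e} = 4\<close> by simp
    then show False using card_verts[OF ab] by simp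
  qed
  then obtain y where y: "a \<rightarrow> y" "y \<noteq> b" "y \<noteq> e" by blast
  \<comment> \<open>The whole 4-cycle lies on the side of \<open>a\<close>, so that side has more
    than 2 vertices and must be the one of size 6.\<close>
  have small: "card (W u a) = 2" if u: "a \<rightarrow> u" "u \<noteq> b" "u \<noteq> e" for u
  proof -
    have uV: "u \<in> verts G" using u(1) adj_in_verts by blast
    have "u \<noteq> c" using u(1) c adj_sym dist4 by blast
    then have bu: "2 \<le> d b u" and eu: "2 \<le> d e u"
      using u adj_neq[OF u(1)] b e V uV by (auto intro!: dist_ge_2)
    have "b \<in> W a u" "e \<in> W a u"
      using bu eu V b e dist_eq_1_iff[of b a] dist_eq_1_iff[of e a] by (auto simp: closer_set_def)
    moreover have "c \<in> W a u"
    proof -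
      have "d c a \<le> 2"
        using dist_adj_le[of c b a] dist_eq_1_iff[of c b] V b c by simp
      \<comment> \<open>A shortest path from \<open>c\<close> to \<open>u\<close> starts through
        \<open>b\<close> or \<open>e\<close>, both at distance at least 2 from
        \<open>u\<close>.\<close>
      moreover obtain z where "c \<rightarrow> z" "d u c = Suc (d u z)"
        using dist_predE[OF uV V(3) \<open>u \<noteq> c\<close>] .
      then have "3 \<le> d c u"
        using bu eu c dist_commute uV V by auto
      ultimately show ?thesis using V by (simp add: closer_set_def)
    qed
    moreover have "a \<in> W a u" using self_in_closer_set u by blast
    ultimately have "card {a, b, c, e} \<le> card (W a u)"
      by (intro card_mono) auto
    then show ?thesis using card_closer_sets[OF u(1)] \<open>card {a, b, c, e} = 4\<close> by auto
  qed
  obtain z where z: "z \<noteq> a" "y \<rightarrow> z" "\<And>x. y \<rightarrow> x \<longleftrightarrow> x = a \<or> x = z"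
      "\<And>x. z \<rightarrow> x \<Longrightarrow> x \<noteq> y \<Longrightarrow> a \<rightarrow> x"
    using small_closer_setE[OF y(1) small[OF y]] by metis
  obtain y' where y': "z \<rightarrow> y'" "y' \<noteq> y"
    using second_neighbourE[OF z(2)] by blast
  have az: "\<not> a \<rightarrow> z" using triangle_free[OF y(1) z(2)] .
  have z_new: "z \<noteq> b" "z \<noteq> c" "z \<noteq> e"
    using az ab ae c z(2) y adj_sym by blast+
  have ay': "a \<rightarrow> y'" "y' \<noteq> b" "y' \<noteq> e"
    using z(4)[OF y'] y'(1) z(1) z_new b e adj_sym by blast+
  obtain z' where "\<And>x. y' \<rightarrow> x \<longleftrightarrow> x = a \<or> x = z'"
    using small_closer_setE[OF ay'(1) small[OF ay']] by metis
  then have ny': "y' \<rightarrow> x \<longleftrightarrow> x = a \<or> x = z" for x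
    using y'(1) z(1) adj_sym by metis
  have y_new: "y \<noteq> c" "y' \<noteq> c"
    using y(1) ay'(1) c dist4 adj_sym by blast+
  have V': "y \<in> verts G" "z \<in> verts G" "y' \<in> verts G"
    using z(2) y' adj_in_verts by auto
  let ?S = "{a, b, c, e, y, z, y'}"
  have "card ?S = 7"
    using dist4 y z(1,2) y' ay' z_new y_new adj_neq[OF y(1)] adj_neq[OF z(2)] adj_neq[OF ay'(1)]
      adj_neq[OF y'(1)] by auto
  then have "card (verts G - ?S) = 1"
    using card_verts[OF ab] V V' by (subst card_Diff_subset) auto
  then obtain w where w: "verts G - ?S = {w}" by (rule card_1_singletonE)
  \<comment> \<open>\<open>w\<close> is the eighth vertex. All neighbours of \<open>b\<close>,
    \<open>c\<close>, \<open>e\<close>, \<open>y\<close> and \<open>y'\<close> are already known to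
    lie in \<open>?S\<close>, so only \<open>a\<close> and \<open>z\<close> can be adjacent to
    \<open>w\<close>.\<close>
  have w_nbr: "x = a \<or> x = z" if "w \<rightarrow> x" for x
  proof -
    have "x \<in> verts G" "x \<noteq> w" using adj_in_verts(2)[OF that] adj_neq[OF that] by auto
    moreover have "\<not> x \<rightarrow> v" if "x \<in> {b, c, e, y, y'}" "v \<notin> ?S" for v
      using that b c e z(3) ny' by auto
    ultimately show ?thesis using w adj_sym[OF that] by blast
  qed
  have "w \<in> verts G" using w by blast
  \<comment> \<open>Otherwise \<open>w\<close> would have \<open>a\<close> as its only neighbour,
    but every vertex on an edge has a second neighbour.\<close>
  have "z \<rightarrow> w"
  proof (rule ccontr)
    assume nz: "\<not> z \<rightarrow> w"
    have "w \<rightarrow>\<^sup>* a" "w \<noteq> a" using reach \<open>w \<in> verts G\<close> V(1) w by auto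
    then obtain x where "w \<rightarrow> x" by (auto elim: converse_reachable_cases)
    then have "a \<rightarrow> w" using w_nbr nz adj_sym by blast
    then obtain x where "w \<rightarrow> x" "x \<noteq> a" using second_neighbourE by blast
    then show False using w_nbr nz adj_sym by blast
  qed
  have z_nbr: "v \<in> W z y" if "z \<rightarrow> v" "v \<noteq> y" for v
    using that triangle_free[OF z(2) that(1)] adj_commute[of v] adj_in_verts(2)[OF that(1)] V'
      dist_ge_2[of v y] dist_eq_1_iff[of v z] by (simp add: closer_set_def)
  have w_new: "w \<noteq> y" "w \<noteq> z" "w \<noteq> y'" using w by blast+
  have "{z, y', w} \<subseteq> W z y"
    using z_nbr[OF y'] z_nbr[OF \<open>z \<rightarrow> w\<close>] w_new(1) self_in_closer_set[OF adj_sym[OF z(2)]]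
    by simp
  moreover have "card {z, y', w} = 3"
    using adj_neq[OF y'(1)] w_new by auto
  ultimately have c1: "3 \<le> card (W z y)"
    by (metis card_mono finite_closer_set)
  have az2: "2 \<le> d z a" and cz2: "2 \<le> d z c"
    using az z_new z(1) c adj_commute[of z] V V' by (auto intro!: dist_ge_2)
  have "a \<in> W y z"
    using az2 dist_commute[of a z] dist_eq_1_iff[of a y] y(1) V V' by (simp add: closer_set_def)
  \<comment> \<open>\<open>b\<close> reaches \<open>y\<close> through \<open>a\<close> in two steps,
    while its only neighbours \<open>a\<close> and \<open>c\<close> are both at distance at least 2
    from \<open>z\<close>.\<close>
  moreover have "b \<in> W y z"
  proof -
    have "d b y \<le> 2"
      using dist_adj_le[of b a y] dist_eq_1_iff[of b a] V b y by simp
    moreover obtain v where "b \<rightarrow> v" "d z b = Suc (d z v)"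
      using dist_predE[OF V'(2) V(2) z_new(1)] .
    then have "3 \<le> d b z"
      using az2 cz2 b dist_commute V V' by auto
    ultimately show ?thesis using V by (simp add: closer_set_def)
  qed
  ultimately have "{y, a, b} \<subseteq> W y z"
    using self_in_closer_set z(2) by blast
  moreover have "card {y, a, b} = 3"
    using adj_neq[OF y(1)] y dist4 by auto
  ultimately have "3 \<le> card (W y z)"
    by (metis card_mono finite_closer_set)
  with c1 show False using card_closer_sets[OF z(2)] by auto
qed

text \<open>The part of size 2 consists of the two neighbours \<open>a\<close>, \<open>c\<close> of
  a vertex \<open>b\<close> with \<open>W b a\<close> of size 2; the other part is their common
  neighbourhood. Closure under adjacency makes these all the vertices, and the count 8 gives 6 for
  the second part.\<close>

lemma complete_bipartite_structure:
  assumes "arcs G \<noteq> {}"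
  obtains A B where "card A = 2" "card B = 6" "A \<inter> B = {}" "verts G = A \<union> B"
    "arcs_ends G = A \<times> B \<union> B \<times> A"
proof -
  obtain a b where ab: "a \<rightarrow> b" and small: "card (W b a) = 2"
  proof -
    obtain u v where "u \<rightarrow> v"
      using assms by (auto simp: arcs_ends_conv)
    then show ?thesis using card_closer_sets[of u v] adj_sym that by blast
  qed
  obtain c where c: "c \<noteq> a" "b \<rightarrow> c" "\<And>x. b \<rightarrow> x \<longleftrightarrow> x = a \<or> x = c"
      "\<And>x. c \<rightarrow> x \<Longrightarrow> x \<noteq> b \<Longrightarrow> a \<rightarrow> x"
    using small_closer_setE[OF ab small] by metis
  \<comment> \<open>Otherwise \<open>c\<close> has just one further neighbour \<open>e\<close>, and
    the neighbours of \<open>e\<close> are \<open>a\<close> and \<open>c\<close>, so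
    \<open>b\<close>, \<open>c\<close>, \<open>e\<close> are the three vertices of degree 2 in a
    forbidden 4-cycle.\<close>
  have "card (W c b) \<noteq> 2"
  proof
    assume "card (W c b) = 2"
    then obtain e where e: "e \<noteq> b" "c \<rightarrow> e" "\<And>x. c \<rightarrow> x \<longleftrightarrow> x = b \<or> x = e"
        "\<And>x. e \<rightarrow> x \<Longrightarrow> x \<noteq> c \<Longrightarrow> b \<rightarrow> x"
      using small_closer_setE[OF c(2)] by metis
    have "e \<rightarrow> x \<longleftrightarrow> x = a \<or> x = c" for x
      using e(1,2,4) c(3,4) adj_sym by blast
    from no_pendant_4_cycle[OF c(3) e(3) this c(1)[symmetric] e(1)[symmetric]] show False .
  qed
  then have "card (W b c) = 2" using card_closer_sets[OF c(2)] by auto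
  \<comment> \<open>Applied to the edge \<open>bc\<close> from the side of \<open>b\<close>, the
    small closer set gives the inclusion of neighbourhoods converse to the one from
    \<open>ab\<close>.\<close>
  then obtain a' where "\<And>x. b \<rightarrow> x \<longleftrightarrow> x = c \<or> x = a'" "\<And>x. a' \<rightarrow> x \<Longrightarrow> x \<noteq> b \<Longrightarrow> c \<rightarrow> x"
    using small_closer_setE[OF adj_sym[OF c(2)]] by metis
  moreover from this c(1,3) have "a' = a" by metis
  ultimately have same: "a \<rightarrow> x \<longleftrightarrow> c \<rightarrow> x" for x
    using c ab adj_sym by blast
  have deg2: "u \<rightarrow> x \<longleftrightarrow> x = a \<or> x = c" if u: "a \<rightarrow> u" for u x
  proof (cases "card (W u a) = 2")
    case True
    then obtain v where "\<And>x. u \<rightarrow> x \<longleftrightarrow> x = a \<or> x = v"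
      using small_closer_setE[OF u] by metis
    moreover have "u \<rightarrow> c" using u same adj_sym by blast
    ultimately show ?thesis using c(1) by metis
  next
    case False
    \<comment> \<open>Now \<open>a\<close> has degree 2, and so has \<open>c\<close> with the same
      neighbours \<open>u\<close> and \<open>b\<close>. The forbidden 4-cycle appears with
      \<open>u\<close> as its fourth vertex.\<close>
    then have "card (W a u) = 2" "u \<noteq> b"
      using card_closer_sets[OF u] small by auto
    then obtain v where v: "\<And>x. a \<rightarrow> x \<longleftrightarrow> x = u \<or> x = v"
      using small_closer_setE[OF adj_sym[OF u]] by metis
    then have "v = b" using ab \<open>u \<noteq> b\<close> by metis
    then have na: "a \<rightarrow> x \<longleftrightarrow> x = u \<or> x = b" for x
      using v by simp
    then have nc: "c \<rightarrow> x \<longleftrightarrow> x = u \<or> x = b" for x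
      using same by simp
    from no_pendant_4_cycle[OF na c(3) nc \<open>u \<noteq> b\<close> c(1)[symmetric]] show ?thesis ..
  qed
  define A B where "A = {a, c}" and "B = {x. a \<rightarrow> x}"
  have A: "x \<in> A \<longleftrightarrow> x = a \<or> x = c" and B: "x \<in> B \<longleftrightarrow> a \<rightarrow> x" for x
    by (simp_all add: A_def B_def)
  have "verts G \<subseteq> A \<union> B"
    by (rule closed_imp_verts[of a]) (use adj_in_verts[OF ab] same deg2 in \<open>auto simp: A B\<close>)
  moreover have "A \<union> B \<subseteq> verts G"
    using adj_in_verts c(2) ab by (auto simp: A B)
  ultimately have V: "verts G = A \<union> B" by blast
  have disj: "A \<inter> B = {}"
    using adj_neq[of a a] triangle_free[OF ab c(2)] by (auto simp: A B)
  have card_A: "card A = 2" using c(1) by (simp add: A_def)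
  have "finite A" "finite B" using V finite_verts by simp_all
  then have card_B: "card B = 6"
    using card_Un_disjoint[OF _ _ disj] V card_verts[OF ab] card_A by simp
  have "x \<rightarrow> y \<longleftrightarrow> x \<in> A \<and> y \<in> B \<or> x \<in> B \<and> y \<in> A" for x y
  proof
    assume xy: "x \<rightarrow> y"
    then have "x \<in> A \<union> B" using adj_in_verts V by blast
    then show "x \<in> A \<and> y \<in> B \<or> x \<in> B \<and> y \<in> A"
      using xy same deg2 unfolding Un_iff A B by blast
  next
    assume "x \<in> A \<and> y \<in> B \<or> x \<in> B \<and> y \<in> A"
    then show "x \<rightarrow> y" using same adj_sym unfolding A B by blast
  qed
  then have "arcs_ends G = A \<times> B \<union> B \<times> A" by auto
  then show ?thesis using that card_A card_B disj V by blast
qed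

end

section \<open>Complete bipartite graphs\<close>

text \<open>Reduces isomorphism, which also maps arcs, to a partition of the vertices and the
  adjacency relation. One direction pulls the two sides back along the vertex map; the other glues
  bijections of the sides.\<close>

lemma (in digraph) digraph_iso_complete_bipartite_iff:
  "digraph_iso G (with_proj (complete_bipartite m n)) \<longleftrightarrow>
    (\<exists>A B. finite A \<and> finite B \<and> card A = m \<and> card B = n \<and> A \<inter> B = {} \<and>
      verts G = A \<union> B \<and> arcs_ends G = A \<times> B \<union> B \<times> A)" (is "?L \<longleftrightarrow> ?R")
proof
  assume ?L
  then obtain f where f: "digraph_isomorphism f" "with_proj (complete_bipartite m n) = app_iso f G"
    unfolding digraph_iso_def by blast
  let ?f = "iso_verts f"
  have inj: "inj_on ?f (verts G)" using f(1) by (rule digraph_isomorphism_inj_on_verts)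
  have vs: "?f ` verts G = Inl ` {..<m} \<union> Inr ` {..<n}"
    using arg_cong[OF f(2), of verts] by (simp add: complete_bipartite_def)
  have "map_prod ?f ?f ` arcs_ends G = arcs_ends (app_iso f G)"
    using f(1) by (force simp: arcs_ends_conv iso_verts_tail iso_verts_head image_image)
  also have "\<dots> = Inl ` {..<m} \<times> Inr ` {..<n} \<union> Inr ` {..<n} \<times> Inl ` {..<m}"
    unfolding f(2)[symmetric] by (simp add: complete_bipartite_def)
  finally have es: "map_prod ?f ?f ` arcs_ends G
      = Inl ` {..<m} \<times> Inr ` {..<n} \<union> Inr ` {..<n} \<times> Inl ` {..<m}" .
  define A where "A = {v \<in> verts G. ?f v \<in> Inl ` {..<m}}"
  define B where "B = {v \<in> verts G. ?f v \<in> Inr ` {..<n}}"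
  have "?f ` A = ?f ` verts G \<inter> Inl ` {..<m}" "?f ` B = ?f ` verts G \<inter> Inr ` {..<n}"
    by (auto simp: A_def B_def)
  then have fA: "?f ` A = Inl ` {..<m}" and fB: "?f ` B = Inr ` {..<n}"
    unfolding vs by auto
  have "card A = card (?f ` A)" "card B = card (?f ` B)"
    by (rule card_image[symmetric], rule inj_on_subset[OF inj], auto simp: A_def B_def)+
  then have "card A = m" "card B = n"
    unfolding fA fB by (simp_all add: card_image)
  moreover have "finite A" "finite B" "A \<inter> B = {}" "verts G = A \<union> B"
    using vs by (auto simp: A_def B_def)
  moreover have "arcs_ends G = A \<times> B \<union> B \<times> A"
  proof -
    \<comment> \<open>Both sets of pairs have the same image under a map injective on pairs of
      vertices, hence they are equal.\<close>
    have "inj_on (map_prod ?f ?f) (verts G \<times> verts G)"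
      using inj by (rule map_prod_inj_on[OF _ inj])
    moreover have "arcs_ends G \<subseteq> verts G \<times> verts G" "A \<times> B \<union> B \<times> A \<subseteq> verts G \<times> verts G"
      using adj_in_verts by (auto simp: A_def B_def)
    moreover have "map_prod ?f ?f ` arcs_ends G = map_prod ?f ?f ` (A \<times> B \<union> B \<times> A)"
      unfolding es image_Un map_prod_surj_on[OF refl refl] fA fB
      by (simp add: map_prod_surj_on[OF fA fB] map_prod_surj_on[OF fB fA])
    ultimately show ?thesis by (simp add: inj_on_image_eq_iff)
  qed
  ultimately show ?R by blast
next
  assume ?R
  then obtain A B where AB: "finite A" "finite B" "card A = m" "card B = n" "A \<inter> B = {}"
    "verts G = A \<union> B" "arcs_ends G = A \<times> B \<union> B \<times> A" by blast
  obtain g h where g: "bij_betw g A {..<m}" and h: "bij_betw h B {..<n}"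
    using AB(1-4) ex_bij_betw_finite_nat lessThan_atLeast0 by metis
  define \<phi> where "\<phi> v = (if v \<in> A then Inl (g v) else Inr (h v))" for v
  have \<phi>A: "\<phi> ` A = Inl ` {..<m}"
    using g by (auto simp: \<phi>_def bij_betw_def image_iff)
  have \<phi>B: "\<phi> ` B = Inr ` {..<n}"
  proof -
    have "\<phi> v = Inr (h v)" if "v \<in> B" for v using that AB(5) by (auto simp: \<phi>_def)
    then have "\<phi> ` B = Inr ` h ` B" by (simp add: image_image)
    then show ?thesis using h by (simp add: bij_betw_def)
  qed
  have inj: "inj_on \<phi> (verts G)"
    using g h AB(5,6) by (auto simp: \<phi>_def inj_on_def bij_betw_def)
  \<comment> \<open>Arcs of the target are pairs of vertices, so each arc goes to the pair of its
    mapped ends. This is injective since \<open>G\<close> has no parallel arcs.\<close>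
  define f where "f = \<lparr>iso_verts = \<phi>, iso_arcs = (\<lambda>e. (\<phi> (tail G e), \<phi> (head G e))),
    iso_head = snd, iso_tail = fst\<rparr>"
  have "digraph_isomorphism f"
    unfolding digraph_isomorphism_def
  proof (intro conjI)
    show "inj_on (iso_arcs f) (arcs G)"
    proof (rule inj_onI)
      fix x y assume xy: "x \<in> arcs G" "y \<in> arcs G" "iso_arcs f x = iso_arcs f y"
      then have "tail G x = tail G y" "head G x = head G y"
        by (auto simp: f_def intro: inj_onD[OF inj])
      then show "x = y" using no_multi_arcs xy by (simp add: arc_to_ends_def)
    qed
  qed (use inj wf_digraph in \<open>auto simp: f_def\<close>)
  moreover have "with_proj (complete_bipartite m n) = app_iso f G"
  proof (rule pre_digraph.equality)
    show "verts (with_proj (complete_bipartite m n)) = verts (app_iso f G)"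
      by (simp add: complete_bipartite_def f_def AB(6) image_Un \<phi>A \<phi>B)
    have "arcs (app_iso f G) = map_prod \<phi> \<phi> ` arcs_ends G"
      by (auto simp: f_def arcs_ends_conv image_image)
    then show "arcs (with_proj (complete_bipartite m n)) = arcs (app_iso f G)"
      by (simp add: complete_bipartite_def AB(7) image_Un map_prod_surj_on[OF \<phi>A \<phi>B]
          map_prod_surj_on[OF \<phi>B \<phi>A])
  qed (simp_all add: f_def)
  ultimately show ?L unfolding digraph_iso_def by blast
qed

text \<open>\<open>W a b\<close> is \<open>B\<close> with \<open>b\<close> replaced by
  \<open>a\<close>: vertices of \<open>B\<close> are at distance 1 from \<open>a\<close> and, except
  \<open>b\<close>, at least 2 from \<open>b\<close>; vertices of \<open>A\<close> are at distance 1
  from \<open>b\<close>, so only \<open>a\<close> itself is closer to \<open>a\<close>.\<close>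

lemma (in connected_graph) card_closer_set_complete_bipartite:
  assumes "A \<inter> B = {}" "verts G = A \<union> B" "arcs_ends G = A \<times> B \<union> B \<times> A"
    and a: "a \<in> A" and b: "b \<in> B"
  shows "card (W a b) = card B"
proof -
  have adj: "x \<rightarrow> y \<longleftrightarrow> x \<in> A \<and> y \<in> B \<or> x \<in> B \<and> y \<in> A" for x y
    using assms(3) by auto
  have V: "a \<in> verts G" "b \<in> verts G" using assms by auto
  have 1: "d x a < d x b \<longleftrightarrow> x \<noteq> b" if x: "x \<in> B" for x
  proof -
    have "d x a = 1" using x a adj assms(2) dist_eq_1_iff by auto
    moreover have "d x b \<noteq> 1" using x b adj assms(1,2) dist_eq_1_iff by auto
    moreover have "d x b = 0 \<longleftrightarrow> x = b" using x assms(2) dist_eq_0_iff V by auto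
    ultimately show ?thesis by linarith
  qed
  have 2: "d x a < d x b \<longleftrightarrow> x = a" if x: "x \<in> A" for x
  proof -
    have "d x b = 1" using x b adj assms(2) dist_eq_1_iff by auto
    moreover have "d x a = 0 \<longleftrightarrow> x = a" using x assms(2) dist_eq_0_iff V by auto
    ultimately show ?thesis by linarith
  qed
  have "W a b = insert a (B - {b})"
    using 1 2 a assms(2) by (auto simp: closer_set_def)
  moreover have "finite B" "a \<notin> B" using finite_verts assms(1,2) a by auto
  ultimately show ?thesis
    using b by (simp add: card_Suc_Diff1 del: card_Diff_insert)
qed

theorem theorem2p5:
  fixes G :: "('a, 'b) pre_digraph"
  assumes "graph G" and "connected G" and "arcs G \<noteq> {}"
  shows "three_GNDB_with G 2 \<longleftrightarrow> digraph_iso G (with_proj (complete_bipartite 2 6))"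
proof -
  interpret connected_graph G
    using assms(1,2) by (simp add: connected_graph_def connected_graph_axioms_def)
  show ?thesis
    unfolding digraph_iso_complete_bipartite_iff
  proof
    assume "three_GNDB_with G 2"
    then interpret gndb_2 G by unfold_locales
    obtain A B where "card A = 2" "card B = 6" "A \<inter> B = {}" "verts G = A \<union> B"
      "arcs_ends G = A \<times> B \<union> B \<times> A"
      using complete_bipartite_structure[OF assms(3)] .
    moreover from this have "finite A" "finite B" using finite_verts by simp_all
    ultimately show "\<exists>A B. finite A \<and> finite B \<and> card A = 2 \<and> card B = 6 \<and> A \<inter> B = {} \<and>
      verts G = A \<union> B \<and> arcs_ends G = A \<times> B \<union> B \<times> A" by blast
  next
    assume "\<exists>A B. finite A \<and> finite B \<and> card A = 2 \<and> card B = 6 \<and> A \<inter> B = {} \<and>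
      verts G = A \<union> B \<and> arcs_ends G = A \<times> B \<union> B \<times> A"
    then obtain A B where AB: "card A = 2" "card B = 6" "A \<inter> B = {}" "verts G = A \<union> B"
      "arcs_ends G = A \<times> B \<union> B \<times> A" by blast
    have BA: "B \<inter> A = {}" "verts G = B \<union> A" "arcs_ends G = B \<times> A \<union> A \<times> B"
      using AB by auto
    \<comment> \<open>The count is used twice, with the roles of the two parts exchanged the second
      time.\<close>
    have "card (W a b) = 6 \<and> card (W b a) = 2" if "a \<in> A" "b \<in> B" for a b
      using card_closer_set_complete_bipartite[OF AB(3-5) that]
        card_closer_set_complete_bipartite[OF BA that(2,1)] AB(1,2) by simp
    then show "three_GNDB_with G 2"
      unfolding three_GNDB_with_def AB(5) by auto
  qed
qed

end
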